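(* Let $\mathbf{D}$ be the open unit disk of $\mathbb{C}$, let $x,y\in\mathbf{D}$ be not both zero, and let $z\in\mathbb{C}$ be such that $$|z|\le\frac{1+\max\{|x|,|y|\}}{2\max\{|x|,|y|\}}.$$ Then $zx,zy\in\mathbf{D}$ and, whenever $z\ne0$ and $x\neq y$, $$\frac{\rho(zx,zy)}{|z|\,\rho(x,y)}\le 2 .$$
   Context: For $a,b\in\mathbf{D}$, $\rho(a,b)=\left|\frac{a-b}{1-\bar a b}\right|$ is the pseudohyperbolic distance. *)

theory Defs
  imports "HOL-Analysis.Analysis"
begin

abbreviation unit_disk :: "complex set" where
  "unit_disk \<equiv> ball 0 1"

text \<open>The pseudohyperbolic distance. It is meant for arguments in the unit disk, where the
  denominator does not vanish.\<close>

definition pseudohyp :: "complex \<Rightarrow> complex \<Rightarrow> real" where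
  "pseudohyp a b = cmod ((a - b) / (1 - cnj a * b))"

end

theory Submission
  imports Defs
begin

text \<open>
  Put \<open>w = cnj x * y\<close> and \<open>s = \<bar>z\<bar>\<^sup>2\<close>. Since \<open>zx - zy = z (x - y)\<close> and \<open>cnj (zx) (zy) = s w\<close>,
  the numerators cancel in the quotient of the two distances, which is therefore
  \<open>\<bar>1 - w\<bar> / \<bar>1 - s w\<bar>\<close>.

  For fixed \<open>\<bar>w\<bar> = r\<close>, the difference \<open>4 \<bar>1 - s w\<bar>\<^sup>2 - \<bar>1 - w\<bar>\<^sup>2\<close> is an affine function of \<open>Re w\<close>
  on \<open>[-r, r]\<close>, so it is nonnegative as soon as it is so at the real points \<open>w = r\<close> and \<open>w = -r\<close>.
  At \<open>w = -r\<close> there is no obstruction; at \<open>w = r\<close> the condition is \<open>1 - r \<le> 2 (1 - s r)\<close>, that is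
  \<open>2 s r \<le> 1 + r\<close> (lemma \<open>norm_one_minus_le_twice\<close>).

  With \<open>M = max \<bar>x\<bar> \<bar>y\<bar>\<close> we have \<open>r \<le> M\<^sup>2\<close>, and the hypothesis on \<open>z\<close> says that
  \<open>\<bar>z\<bar> M \<le> (1 + M) / 2\<close>, the midpoint of \<open>M\<close> and \<open>1\<close>. This puts \<open>zx\<close> and \<open>zy\<close> in the disk, and
  the condition at \<open>w = r\<close> then reduces to \<open>(1 - M)\<^sup>2 \<ge> 0\<close> (lemma \<open>dilation_condition\<close>).
\<close>

lemma norm_one_minus_le_twice:
  fixes w :: complex and s :: real
  assumes "cmod w \<le> 1" and "0 \<le> s" and "2 * s * cmod w \<le> 1 + cmod w"
  shows "cmod (1 - w) \<le> 2 * cmod (1 - of_real s * w)"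
proof -
  define r where "r = cmod w"
  define u where "u = Re w"
  have r: "0 \<le> r" "r \<le> 1" "2 * s * r \<le> 1 + r" and sr: "0 \<le> s * r"
    using assms by (auto simp: r_def)
  have u: "u \<le> r" "- r \<le> u"
    using abs_Re_le_cmod[of w] by (auto simp: u_def r_def)
  have norm_sq: "(cmod (1 - of_real t * w))\<^sup>2 = 1 - 2 * t * u + t\<^sup>2 * r\<^sup>2" for t
  proof -
    have "r\<^sup>2 = u\<^sup>2 + (Im w)\<^sup>2"
      by (simp add: r_def u_def cmod_power2)
    moreover have "(cmod (1 - of_real t * w))\<^sup>2 = (1 - t * u)\<^sup>2 + (t * Im w)\<^sup>2"
      by (simp add: cmod_power2 u_def)
    ultimately show ?thesis
      by (simp add: power2_eq_square algebra_simps)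
  qed
  have ends: "0 \<le> (1 + r - 2 * s * r) * (3 - r - 2 * s * r)"
    "0 \<le> (1 - r + 2 * s * r) * (3 + r + 2 * s * r)"
    using r sr by (auto intro!: mult_nonneg_nonneg)
  have "0 \<le> 3 - (8 * s - 2) * u + (4 * s\<^sup>2 - 1) * r\<^sup>2"
  proof (cases "0 \<le> 8 * s - 2")
    \<comment> \<open>The minimum over \<open>u\<close> is at \<open>u = r\<close> or \<open>u = -r\<close>, according to the sign of the slope.\<close>
    case True
    then have "(8 * s - 2) * u \<le> (8 * s - 2) * r"
      using u by (intro mult_left_mono)
    with ends(1) show ?thesis
      by (simp add: algebra_simps power2_eq_square)
  next
    case False
    then have "(8 * s - 2) * u \<le> (8 * s - 2) * (- r)"
      using u by (intro mult_left_mono_neg) auto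
    with ends(2) show ?thesis
      by (simp add: algebra_simps power2_eq_square)
  qed
  then have "(cmod (1 - w))\<^sup>2 \<le> (2 * cmod (1 - of_real s * w))\<^sup>2"
    using norm_sq[of s] norm_sq[of 1] by (simp add: power_mult_distrib algebra_simps)
  then show ?thesis
    by (rule power2_le_imp_le) simp
qed

text \<open>Both sides are affine in \<open>r\<close>, and the inequality is strict at \<open>r = 0\<close>; so \<open>r = M\<^sup>2\<close> is the
  critical case, where it follows from \<open>(1 + M)\<^sup>2 / 2 \<le> 1 + M\<^sup>2\<close>.\<close>

lemma dilation_condition:
  fixes a M r :: real
  assumes "0 < M" and "0 \<le> a" and "a * M \<le> (1 + M) / 2" and "0 \<le> r" and "r \<le> M\<^sup>2"
  shows "2 * a\<^sup>2 * r \<le> 1 + r"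
proof -
  have "(a * M)\<^sup>2 \<le> ((1 + M) / 2)\<^sup>2"
    using assms by (intro power_mono) auto
  moreover have "2 * ((1 + M) / 2)\<^sup>2 + (1 - M)\<^sup>2 / 2 = 1 + M\<^sup>2"
    by (simp add: power2_eq_square field_simps)
  ultimately have "2 * (a * M)\<^sup>2 - M\<^sup>2 \<le> 1"
    using zero_le_power2[of "1 - M"] by linarith
  then have "r * (2 * (a * M)\<^sup>2 - M\<^sup>2) \<le> r * 1"
    using \<open>0 \<le> r\<close> by (rule mult_left_mono)
  also have "\<dots> \<le> M\<^sup>2"
    using \<open>r \<le> M\<^sup>2\<close> by simp
  finally have "M\<^sup>2 * (2 * a\<^sup>2 * r - r) \<le> M\<^sup>2 * 1"
    by (simp add: algebra_simps power_mult_distrib)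
  then have "2 * a\<^sup>2 * r - r \<le> 1"
    using \<open>0 < M\<close> by (subst (asm) mult_le_cancel_left_pos) auto
  then show ?thesis by simp
qed

lemma pseudohyp_mult:
  "pseudohyp (z * x) (z * y) =
    cmod z * cmod (x - y) / cmod (1 - of_real ((cmod z)\<^sup>2) * (cnj x * y))"
proof -
  have "cnj (z * x) * (z * y) = of_real ((cmod z)\<^sup>2) * (cnj x * y)"
    by (simp add: complex_norm_square mult_ac del: of_real_power)
  then show ?thesis
    unfolding pseudohyp_def norm_divide by (simp only: norm_mult flip: right_diff_distrib)
qed

theorem proposition2p3:
  fixes x y z :: complex
  assumes "x \<in> unit_disk" and "y \<in> unit_disk"
    and "\<not> (x = 0 \<and> y = 0)"
    and "cmod z \<le> (1 + max (cmod x) (cmod y)) / (2 * max (cmod x) (cmod y))"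
  shows "z * x \<in> unit_disk \<and> z * y \<in> unit_disk \<and>
    (z \<noteq> 0 \<and> x \<noteq> y \<longrightarrow>
      pseudohyp (z * x) (z * y) / (cmod z * pseudohyp x y) \<le> 2)"
proof -
  define M where "M = max (cmod x) (cmod y)"
  have xM: "cmod x \<le> M" and yM: "cmod y \<le> M" and M: "0 < M" "M < 1"
    using assms(1-3) by (auto simp: M_def less_max_iff_disj)
  have zM: "cmod z * M \<le> (1 + M) / 2"
    using assms(4) M by (simp add: M_def[symmetric] field_simps)
  have in_disk: "z * v \<in> unit_disk" if "cmod v \<le> M" for v
  proof -
    have "cmod z * cmod v \<le> cmod z * M"
      using that by (intro mult_left_mono) auto
    then show ?thesis
      using zM M by (simp add: norm_mult)
  qed
  have "pseudohyp (z * x) (z * y) / (cmod z * pseudohyp x y) \<le> 2" if "z \<noteq> 0" "x \<noteq> y"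
  proof -
    define w where "w = cnj x * y"
    define D where "D = cmod (1 - of_real ((cmod z)\<^sup>2) * w)"
    have wM: "cmod w \<le> M\<^sup>2"
      using xM yM M by (simp add: w_def norm_mult power2_eq_square mult_mono)
    have w1: "cmod w < 1"
      using wM M power_strict_mono[of M 1 2] by simp
    have "2 * (cmod z)\<^sup>2 * cmod w \<le> 1 + cmod w"
      using M zM wM by (intro dilation_condition) auto
    then have le: "cmod (1 - w) \<le> 2 * D"
      unfolding D_def using w1 by (intro norm_one_minus_le_twice) auto
    have pos: "0 < cmod (1 - w)"
      using w1 by auto
    then have "0 < D"
      using le by linarith
    moreover have "pseudohyp (z * x) (z * y) = cmod z * cmod (x - y) / D"
      by (simp add: pseudohyp_mult D_def w_def)
    moreover have "pseudohyp x y = cmod (x - y) / cmod (1 - w)"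
      by (simp add: pseudohyp_def w_def norm_divide)
    ultimately have "pseudohyp (z * x) (z * y) / (cmod z * pseudohyp x y) = cmod (1 - w) / D"
      using that pos by simp
    also have "\<dots> \<le> 2"
      using le \<open>0 < D\<close> by (simp add: field_simps)
    finally show ?thesis .
  qed
  then show ?thesis
    using in_disk[OF xM] in_disk[OF yM] by blast
qed

end
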